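(* $\operatorname{add}(\mathcal{N})_{\mathrm{game}}^{\mathrm{I}} = \operatorname{add}(\mathcal{N})$.
   Context: $\operatorname{add}(\mathcal{N})$ is the additivity of the Lebesgue null ideal. For $k\in\omega$, $[\omega]^{k+1}$ denotes the set of subsets of $\omega$ of size $k+1$. For $\mathcal{A}\subseteq\omega^\omega$, the anti-localizing game with respect to $\mathcal{A}$: at round $k$, Player I plays $a_k\in[\omega]^{k+1}$ and then Player II plays $i_k\in\{0,1\}$. Player II wins iff $i_k=1$ for infinitely many $k$ and there is $x\in\mathcal{A}$ with $\{k: i_k=1\}=\{k: x(k)\notin a_k\}$. $\operatorname{add}(\mathcal{N})_{\mathrm{game}}^{\mathrm{I}}$ is the least $|\mathcal{A}|$ such that Player I has no winning strategy in the anti-localizing game with respect to $\mathcal{A}$. *)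

theory Defs
  imports "HOL-Analysis.Analysis"
begin

definition addN_family :: "real set set \<Rightarrow> bool" where
  "addN_family F \<longleftrightarrow> F \<subseteq> null_sets lebesgue \<and> \<Union>F \<notin> null_sets lebesgue"

definition addN_min :: "real set set \<Rightarrow> bool" where
  "addN_min F \<longleftrightarrow> addN_family F \<and> (\<forall>F'. addN_family F' \<longrightarrow> (card_of F, card_of F') \<in> ordLeq)"

text \<open>A strategy for Player I maps the finite history of Player II's moves
  (a list of length k) to Player I's move at round k, a subset of omega of size k+1.\<close>
definition strategyI :: "(bool list \<Rightarrow> nat set) \<Rightarrow> bool" where
  "strategyI \<sigma> \<longleftrightarrow> (\<forall>s. finite (\<sigma> s) \<and> card (\<sigma> s) = length s + 1)"

text \<open>Player I's move at round k in the play where Player II plays i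
  (True corresponds to 1, False to 0).\<close>
definition playI :: "(bool list \<Rightarrow> nat set) \<Rightarrow> (nat \<Rightarrow> bool) \<Rightarrow> nat \<Rightarrow> nat set" where
  "playI \<sigma> i k = \<sigma> (map i [0..<k])"

definition II_wins :: "(nat \<Rightarrow> nat) set \<Rightarrow> (nat \<Rightarrow> nat set) \<Rightarrow> (nat \<Rightarrow> bool) \<Rightarrow> bool" where
  "II_wins \<A> a i \<longleftrightarrow> infinite {k. i k} \<and> (\<exists>x\<in>\<A>. \<forall>k. i k \<longleftrightarrow> x k \<notin> a k)"

definition I_winning_strategy :: "(nat \<Rightarrow> nat) set \<Rightarrow> (bool list \<Rightarrow> nat set) \<Rightarrow> bool" where
  "I_winning_strategy \<A> \<sigma> \<longleftrightarrow> strategyI \<sigma> \<and> (\<forall>i. \<not> II_wins \<A> (playI \<sigma> i) i)"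

definition game_family :: "(nat \<Rightarrow> nat) set \<Rightarrow> bool" where
  "game_family \<A> \<longleftrightarrow> \<not> (\<exists>\<sigma>. I_winning_strategy \<A> \<sigma>)"

definition game_min :: "(nat \<Rightarrow> nat) set \<Rightarrow> bool" where
  "game_min \<A> \<longleftrightarrow> game_family \<A> \<and> (\<forall>\<A>'. game_family \<A>' \<longrightarrow> (card_of \<A>, card_of \<A>') \<in> ordLeq)"

end

(* Both directions go through localization of functions by slaloms.

Since Player II can only win by answering truthfully according to some x in the family, a
strategy of Player I beats x iff these answers are eventually 0. From then on the strategy plays
along one of the countably many histories "s followed by zeros", so a winning strategy amounts
to countably many slaloms such that every x in the family is localized by one of them.

If X is null, then X is contained in limsup_k D(f k) for codes f k of sets of measure at most
4^-k. A slalom of width k + 1 that localizes f yields a null set containing X, and countably many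
slaloms still yield a null set. Hence families of null sets with a non-null union give games that
Player I does not win.

Conversely, for fixed n let G_{n,k} be independent open subsets of [0,1) of measure 2^-(n+1), and
send x to limsup_n G_{n,x(n)}. If the union of these null sets is null, it misses a closed set K of
positive measure, and by Baire's theorem some portion of K misses G_{n,x(n)} for almost all n. For
each basic portion, independence bounds the number of k for which G_{n,k} is missed, which gives
countably many slaloms of a fixed width. These are merged into one, and coding x in blocks reduces
its width to k + 1. *)

theory Submission
  imports Defs
begin

unbundle cardinal_syntax

section \<open>Independent open sets\<close>

definition periodic_window :: "nat \<Rightarrow> real set" where
  "periodic_window q = (\<Union>j::int. {of_int j<..<of_int j + 1 / real q})"

text \<open>The digit of t at place k + 1 after the point, in base q, is 0. Left endpoints of the
  digit intervals are excluded so that the set is open. With \<open>q = 2 ^ Suc n\<close> these are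
  the independent sets G_{n,k}.\<close>

definition digit_zero :: "nat \<Rightarrow> nat \<Rightarrow> real set" where
  "digit_zero q k = {t. real q ^ k * t \<in> periodic_window q}"

definition digits_avoid :: "nat \<Rightarrow> nat set \<Rightarrow> real set" where
  "digits_avoid q S = {t. \<forall>k\<in>S. t \<notin> digit_zero q k}"

lemma open_digit_zero: "open (digit_zero q k)"
proof -
  have "open (periodic_window q)"
    unfolding periodic_window_def by (intro open_UN) auto
  moreover have "continuous_on UNIV (\<lambda>t::real. real q ^ k * t)"
    by (intro continuous_intros)
  ultimately have "open ((\<lambda>t::real. real q ^ k * t) -` periodic_window q)"
    by (rule open_vimage)
  then show ?thesis by (simp add: digit_zero_def vimage_def)
qed

lemma closed_digits_avoid: "closed (digits_avoid q S)"
proof -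
  have "digits_avoid q S = (\<Inter>k\<in>S. - digit_zero q k)"
    by (auto simp: digits_avoid_def)
  then show ?thesis
    by (simp add: closed_INT open_digit_zero closed_Compl)
qed

lemma periodic_window_shift: "x + real_of_int n \<in> periodic_window q \<longleftrightarrow> x \<in> periodic_window q"
proof -
  have "x + of_int m \<in> periodic_window q" if x: "x \<in> periodic_window q" for x and m :: int
  proof -
    from x obtain j :: int where "of_int j < x" "x < of_int j + 1 / real q"
      by (auto simp: periodic_window_def)
    then have "x + of_int m \<in> {of_int (j + m)<..<of_int (j + m) + 1 / real q}"
      by auto
    then show ?thesis unfolding periodic_window_def by blast
  qed
  from this[of x n] this[of "x + of_int n" "- n"] show ?thesis by auto
qed

lemma digit_zero_shift: "t + real j \<in> digit_zero q k \<longleftrightarrow> t \<in> digit_zero q k"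
proof -
  have "real q ^ k * (t + real j) = real q ^ k * t + real_of_int (int (q ^ k * j))"
    by (simp add: algebra_simps)
  then show ?thesis
    unfolding digit_zero_def mem_Collect_eq by (metis periodic_window_shift)
qed

lemma digits_avoid_shift: "t + real j \<in> digits_avoid q S \<longleftrightarrow> t \<in> digits_avoid q S"
  by (simp add: digits_avoid_def digit_zero_shift)

section \<open>Measure of sets that avoid prescribed digits\<close>

lemma measure_lborel_affine:
  fixes c t :: real
  assumes "c > 0" "A \<in> sets borel"
  shows "measure lborel A = c * measure lborel {x. t + c * x \<in> A}"
proof -
  have m: "(\<lambda>x. t + c * x) \<in> measurable lborel borel" by simp
  have "emeasure lborel A = emeasure (density (distr lborel borel (\<lambda>x. t + c * x)) (\<lambda>_. ennreal \<bar>c\<bar>)) A"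
    using lborel_real_affine[of c t] assms by simp
  also have "\<dots> = ennreal c * emeasure (distr lborel borel (\<lambda>x. t + c * x)) A"
    using assms by (subst emeasure_density_const) auto
  also have "\<dots> = ennreal c * emeasure lborel {x. t + c * x \<in> A}"
    using assms by (subst emeasure_distr[OF m]) (auto simp: vimage_def)
  finally show ?thesis
    using assms by (simp add: measure_def enn2real_mult)
qed

text \<open>Where q * t lies in [j, j + 1), periodicity makes B part of a copy of A within [0,1),
  shrunk by the factor q. Summing over J gives the bound. The point 0 is exempt because the open
  windows miss their left endpoint.\<close>

lemma measure_dilated_periodic_le:
  fixes A B :: "real set"
  assumes A: "A \<in> sets borel" and per: "\<And>t j. t + real j \<in> A \<longleftrightarrow> t \<in> A"
    and q: "q > 0" and J: "finite J"
    and B: "B \<subseteq> {t. real q * t \<in> A}"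
    and BJ: "\<And>t. t \<in> B \<Longrightarrow> t = 0 \<or> (\<exists>j\<in>J. real j \<le> real q * t \<and> real q * t < real j + 1)"
  shows "measure lborel B \<le> real (card J) / real q * measure lborel (A \<inter> {0..<1})"
proof -
  define P where "P j = {x. - real j + real q * x \<in> A \<inter> {0..<1}}" for j
  have A1: "A \<inter> {0..<1} \<in> sets borel" using A by simp
  have Pm: "P j \<in> sets lborel" for j
  proof -
    have "(\<lambda>x. - real j + real q * x) -` (A \<inter> {0..<1}) \<inter> space borel \<in> sets borel"
      by (rule measurable_sets[OF _ A1]) simp
    then show ?thesis by (simp add: P_def vimage_def)
  qed
  have meas: "measure lborel (P j) = measure lborel (A \<inter> {0..<1}) / real q" for j
    using measure_lborel_affine[OF _ A1, of "real q" "- real j"] q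
    by (simp add: P_def field_simps)
  have fin: "emeasure lborel (P j) < \<infinity>" for j
  proof -
    have "P j \<subseteq> {real j / real q .. (real j + 1) / real q}"
      using q by (auto simp: P_def field_simps)
    then have "emeasure lborel (P j) \<le> emeasure lborel {real j / real q .. (real j + 1) / real q}"
      by (intro emeasure_mono) auto
    also have "\<dots> < \<infinity>" by (simp add: emeasure_lborel_Icc_eq)
    finally show ?thesis .
  qed
  let ?U = "{0} \<union> (\<Union>j\<in>J. P j)"
  have sub: "B \<subseteq> ?U"
  proof
    fix t assume t: "t \<in> B"
    show "t \<in> ?U"
    proof (cases "t = 0")
      case False
      with BJ[OF t] obtain j where j: "j \<in> J" "real j \<le> real q * t" "real q * t < real j + 1"
        by auto
      have "- real j + real q * t \<in> A"
        using per[of "- real j + real q * t" j] B t by auto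
      with j have "t \<in> P j" by (auto simp: P_def)
      with j show ?thesis by auto
    qed simp
  qed
  have Um: "(\<Union>j\<in>J. P j) \<in> sets lborel" using Pm J by auto
  have Ufin: "emeasure lborel (\<Union>j\<in>J. P j) < \<infinity>"
  proof -
    have "emeasure lborel (\<Union>j\<in>J. P j) \<le> (\<Sum>j\<in>J. emeasure lborel (P j))"
      using Pm J by (intro emeasure_subadditive_finite) auto
    also have "\<dots> < \<infinity>" using J fin by simp
    finally show ?thesis .
  qed
  have Ul: "?U \<in> fmeasurable lborel"
    using Um Ufin by (intro fmeasurable.Un) (auto simp: fmeasurable_def)
  have "measure lborel B \<le> measure lborel ?U"
  proof (cases "B \<in> sets lborel")
    \<comment> \<open>A non-measurable B has \<open>measure\<close> 0 by convention, so only this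
      case has content.\<close>
    case True then show ?thesis using sub Ul by (intro measure_mono_fmeasurable) auto
  qed (simp add: measure_notin_sets)
  also have "\<dots> \<le> measure lborel {0::real} + measure lborel (\<Union>j\<in>J. P j)"
    using Um by (intro measure_Un_le) auto
  also have "\<dots> \<le> (\<Sum>j\<in>J. measure lborel (P j))"
    using measure_UNION_le[OF J, of P lborel] Pm by simp
  also have "\<dots> = real (card J) / real q * measure lborel (A \<inter> {0..<1})"
    by (simp add: meas)
  finally show ?thesis .
qed

lemma unit_interval_digit:
  fixes t :: real
  assumes "0 \<le> t" "t < 1" "q > 0"
  obtains j where "j < q" "real j \<le> real q * t" "real q * t < real j + 1"
proof
  let ?j = "nat \<lfloor>real q * t\<rfloor>"
  have nn: "0 \<le> real q * t" using assms by simp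
  then show 1: "real ?j \<le> real q * t" by linarith
  show "real q * t < real ?j + 1" using nn by linarith
  have "real q * t < real q" using assms by simp
  with 1 show "?j < q" by linarith
qed

text \<open>Independence of the digits, by induction: multiplication by q drops the first digit and
  shifts the others down, so each constraint costs one factor 1 - 1/q.\<close>

lemma measure_digits_avoid_le:
  assumes q: "q > 0"
  shows "S \<subseteq> {..<N} \<Longrightarrow>
    measure lborel (digits_avoid q S \<inter> {0..<1}) \<le> (1 - 1 / real q) ^ card S"
proof (induction N arbitrary: S)
  case 0
  then show ?case by (simp add: digits_avoid_def)
next
  case (Suc N)
  define S' where "S' = {k. Suc k \<in> S}"
  have S': "S' \<subseteq> {..<N}" using Suc.prems by (auto simp: S'_def)
  then have finS': "finite S'" using finite_subset by blast
  let ?A = "digits_avoid q S'"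
  have Am: "?A \<in> sets borel" using closed_digits_avoid by simp
  have step: "t \<in> digits_avoid q S \<longleftrightarrow> (0 \<in> S \<longrightarrow> t \<notin> periodic_window q) \<and> real q * t \<in> ?A" for t
  proof -
    have "t \<in> digit_zero q (Suc k) \<longleftrightarrow> real q * t \<in> digit_zero q k" for k
      by (simp add: digit_zero_def mult.assoc mult.left_commute)
    moreover have "t \<in> digit_zero q 0 \<longleftrightarrow> t \<in> periodic_window q"
      by (simp add: digit_zero_def)
    moreover have "(\<forall>k\<in>S. Q k) \<longleftrightarrow> (0 \<in> S \<longrightarrow> Q 0) \<and> (\<forall>k\<in>S'. Q (Suc k))" for Q
    proof (intro iffI conjI ballI impI)
      fix k assume *: "(0 \<in> S \<longrightarrow> Q 0) \<and> (\<forall>k\<in>S'. Q (Suc k))" "k \<in> S"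
      then show "Q k" by (cases k) (auto simp: S'_def)
    qed (auto simp: S'_def)
    ultimately show ?thesis by (simp add: digits_avoid_def)
  qed
  \<comment> \<open>The admissible values of the first digit.\<close>
  define J where "J = (if 0 \<in> S then {1..<q} else {..<q})"
  have J: "real (card J) / real q = (if 0 \<in> S then 1 - 1 / real q else 1)"
    using q by (auto simp: J_def field_simps of_nat_diff)
  have "measure lborel (digits_avoid q S \<inter> {0..<1})
      \<le> real (card J) / real q * measure lborel (?A \<inter> {0..<1})"
  proof (rule measure_dilated_periodic_le[OF Am digits_avoid_shift q])
    show "finite J" by (simp add: J_def)
    show "digits_avoid q S \<inter> {0..<1} \<subseteq> {t. real q * t \<in> ?A}" using step by auto
  next
    fix t assume t: "t \<in> digits_avoid q S \<inter> {0..<1}"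
    then obtain j where j: "j < q" "real j \<le> real q * t" "real q * t < real j + 1"
      using unit_interval_digit q by (metis IntD2 atLeastLessThan_iff)
    show "t = 0 \<or> (\<exists>j\<in>J. real j \<le> real q * t \<and> real q * t < real j + 1)"
    proof (cases "j \<in> J")
      case True with j show ?thesis by blast
    next
      case False
      with j have S0: "0 \<in> S" and "j = 0" by (auto simp: J_def split: if_splits)
      \<comment> \<open>First digit 0, yet outside the open window: only the endpoint t = 0 is
        left.\<close>
      with j q have "t < 1 / real q" by (simp add: field_simps)
      moreover have "t \<notin> periodic_window q" using step t S0 by auto
      ultimately have "\<not> 0 < t" by (auto simp: periodic_window_def dest: spec[of _ 0])
      with t show ?thesis by auto
    qed
  qed
  also have "\<dots> \<le> real (card J) / real q * (1 - 1 / real q) ^ card S'"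
    using Suc.IH[OF S'] by (intro mult_left_mono) auto
  also have "\<dots> = (1 - 1 / real q) ^ card S"
  proof -
    have "S = (if 0 \<in> S then insert 0 (Suc ` S') else Suc ` S')"
      by (auto simp: S'_def image_iff) (metis not0_implies_Suc)+
    then have "card S = (if 0 \<in> S then Suc (card S') else card S')"
      using finS' by (smt (verit) card_image card_insert_disjoint finite_imageI image_iff inj_Suc nat.distinct(1))
    then show ?thesis by (simp add: J)
  qed
  finally show ?case .
qed

lemma measure_digit_zero_le:
  assumes q: "q > 0"
  shows "measure lborel (digit_zero q k \<inter> {0..<1}) \<le> 1 / real q"
proof -
  let ?W = "periodic_window q"
  have W: "open ?W" unfolding periodic_window_def by (intro open_UN) auto
  have shift: "t + real j \<in> ?W \<longleftrightarrow> t \<in> ?W" for t j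
    using periodic_window_shift[of t "int j" q] by simp
  have "measure lborel (digit_zero q k \<inter> {0..<1})
      \<le> real (card {..<q ^ k}) / real (q ^ k) * measure lborel (?W \<inter> {0..<1})"
  proof (rule measure_dilated_periodic_le[OF _ shift])
    fix t assume "t \<in> digit_zero q k \<inter> {0..<1}"
    then show "t = 0 \<or> (\<exists>j\<in>{..<q ^ k}. real j \<le> real (q ^ k) * t \<and> real (q ^ k) * t < real j + 1)"
      using unit_interval_digit[of t "q ^ k"] q
      by (metis IntD2 atLeastLessThan_iff lessThan_iff zero_less_power)
  qed (use W q in \<open>auto simp: digit_zero_def\<close>)
  also have "\<dots> = measure lborel (?W \<inter> {0..<1})" using q by simp
  also have "\<dots> \<le> measure lborel {0..1 / real q}"
  proof (rule measure_mono_fmeasurable)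
    show "?W \<inter> {0..<1} \<subseteq> {0..1 / real q}"
    proof
      fix t assume t: "t \<in> ?W \<inter> {0..<1}"
      then obtain j :: int where j: "of_int j < t" "t < of_int j + 1 / real q"
        by (auto simp: periodic_window_def)
      \<comment> \<open>Windows have length at most 1, so within [0,1) only the one starting at 0
        matters.\<close>
      have "1 / real q \<le> 1" using q by simp
      with j t have "real_of_int j < 1" "- 1 < real_of_int j" by auto
      then have "j = 0" by simp
      with j t show "t \<in> {0..1 / real q}" by auto
    qed
  qed (use W in \<open>simp_all add: fmeasurable_compact borel_open\<close>)
  also have "\<dots> = 1 / real q" by simp
  finally show ?thesis .
qed

text \<open>Avoiding many digits forces small measure, so a set of measure at least \<delta> avoids
  at most q / \<delta> of them.\<close>

lemma card_le_if_avoids_digits: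
  assumes q: "q > 0" and finS: "finite S" and E: "E \<subseteq> digits_avoid q S \<inter> {0..<1}"
    and \<delta>: "\<delta> > 0" "\<delta> \<le> measure lborel E"
  shows "real (card S) * \<delta> \<le> real q"
proof -
  obtain N where N: "S \<subseteq> {..<N}" using finS finite_nat_iff_bounded by blast
  let ?s = "real (card S)" and ?p = "1 / real q"
  have p: "0 < ?p" "?p \<le> 1" using q by auto
  have "\<delta> \<le> measure lborel (digits_avoid q S \<inter> {0..<1})"
  proof (cases "E \<in> sets lborel")
    case True
    have "digits_avoid q S \<inter> {0..<1} \<in> fmeasurable lborel"
      by (rule fmeasurableI2[of "{0..1}"]) (simp_all add: closed_digits_avoid borel_closed fmeasurable_compact subset_eq)
    with True E \<delta> show ?thesis
      by (meson measure_mono_fmeasurable order_trans)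
  next
    case False
    with \<delta> show ?thesis by (simp add: measure_notin_sets)
  qed
  also have "\<dots> \<le> (1 - ?p) ^ card S"
    by (rule measure_digits_avoid_le[OF q N])
  finally have le: "\<delta> \<le> (1 - ?p) ^ card S" .
  \<comment> \<open>Bernoulli's inequality for 1 + p is multiplied by the decay of (1 - p)^s; since
    (1 + p)(1 - p) <= 1, the powers cancel to at most 1.\<close>
  have "(?s * ?p) * \<delta> \<le> (1 + ?p) ^ card S * (1 - ?p) ^ card S"
  proof (rule mult_mono[OF _ le])
    have "1 + ?s * ?p \<le> (1 + ?p) ^ card S"
      using p by (intro Bernoulli_inequality) linarith
    then show "?s * ?p \<le> (1 + ?p) ^ card S" by linarith
  qed (use p \<delta> in auto)
  also have "\<dots> = (1 - ?p ^ 2) ^ card S"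
    by (simp add: power_mult_distrib[symmetric] algebra_simps power2_eq_square)
  also have "\<dots> \<le> 1" using p by (intro power_le_one) (auto simp: power_le_one)
  finally show ?thesis using q by (simp add: field_simps)
qed

section \<open>From null sets to slaloms\<close>

definition digit_limsup :: "(nat \<Rightarrow> nat) \<Rightarrow> real set" where
  "digit_limsup x = {t \<in> {0..<1}. \<exists>\<^sub>\<infinity>n. t \<in> digit_zero (2 ^ Suc n) (x n)}"

lemma null_limsup:
  fixes A :: "nat \<Rightarrow> 'a set"
  assumes "\<And>n. A n \<in> sets M" "\<And>n. emeasure M (A n) \<noteq> \<infinity>" "summable (\<lambda>n. measure M (A n))"
  shows "{t. \<exists>\<^sub>\<infinity>n. t \<in> A n} \<in> null_sets M"
proof -
  have "limsup A = {t. \<exists>\<^sub>\<infinity>n. t \<in> A n}"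
    by (auto simp: limsup_INF_SUP INFM_nat_le)
  then show ?thesis
    using borel_cantelli_limsup1[of A M] assms by (simp add: less_top)
qed

text \<open>Borel-Cantelli: the base \<open>2 ^ Suc n\<close> gives the n-th set measure at most
  2^-(n+1) in [0,1).\<close>

lemma null_digit_limsup: "digit_limsup x \<in> null_sets lebesgue"
proof -
  define G where "G n = digit_zero (2 ^ Suc n) (x n) \<inter> {0..<1}" for n
  have G: "G n \<in> sets lborel" for n
    by (simp add: G_def open_digit_zero borel_open)
  have "emeasure lborel (G n) \<le> emeasure lborel {0..1::real}" for n
    by (intro emeasure_mono) (auto simp: G_def)
  then have fin: "emeasure lborel (G n) \<noteq> \<infinity>" for n
    by (metis emeasure_lborel_Icc ennreal_less_top infinity_ennreal_def leD zero_le_one)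
  have le: "measure lborel (G n) \<le> (1 / 2) ^ Suc n" for n
    using measure_digit_zero_le[of "2 ^ Suc n" "x n"] by (simp add: G_def power_one_over)
  have "summable (\<lambda>n. (1 / 2 :: real) ^ Suc n)"
    by (subst summable_Suc_iff) (simp add: summable_geometric)
  then have "summable (\<lambda>n. measure lborel (G n))"
    by (rule summable_comparison_test'[where N = 0]) (use le in auto)
  from null_limsup[OF G fin this] have "{t. \<exists>\<^sub>\<infinity>n. t \<in> G n} \<in> null_sets lborel" .
  moreover have "digit_limsup x = {t. \<exists>\<^sub>\<infinity>n. t \<in> G n}"
    by (auto simp: digit_limsup_def G_def elim!: INFM_mono dest: INFM_EX)
  ultimately show ?thesis
    by (simp add: null_sets_completionI)
qed

section \<open>Closed sets of locally positive measure and Baire category\<close>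

lemma countable_open_base:
  obtains b :: "nat \<Rightarrow> 'a :: second_countable_topology set"
  where "\<And>i. open (b i)" "\<And>U x. open U \<Longrightarrow> x \<in> U \<Longrightarrow> \<exists>i. x \<in> b i \<and> b i \<subseteq> U"
proof -
  obtain B :: "'a set set" where B: "countable B" "topological_basis B"
    using ex_countable_basis by blast
  have ne: "B \<noteq> {}"
    using topological_basisE[OF B(2) open_UNIV UNIV_I] by blast
  show ?thesis
  proof
    show "open (from_nat_into B i)" for i
      using topological_basis_open[OF B(2)] from_nat_into[OF ne] by blast
    show "\<exists>i. x \<in> from_nat_into B i \<and> from_nat_into B i \<subseteq> U" if "open U" "x \<in> U" for U x
      using topological_basisE[OF B(2) that] from_nat_into_surj[OF B(1)] by metis
  qed
qed

text \<open>The set is shrunk by removing the basic open sets that meet it in a null set.\<close>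

lemma closed_locally_positive_measure_subset:
  fixes K :: "real set"
  assumes K: "closed K" "K \<notin> null_sets lborel" and b: "\<And>i::nat. open (b i)"
  obtains K' where "closed K'" "K' \<subseteq> K" "K' \<noteq> {}"
    "\<forall>i. b i \<inter> K' \<noteq> {} \<longrightarrow> b i \<inter> K' \<notin> null_sets lborel"
proof -
  define Z where "Z = (\<Union>i\<in>{i. b i \<inter> K \<in> null_sets lborel}. b i)"
  have ZK: "Z \<inter> K \<in> null_sets lborel"
  proof -
    have "(\<Union>i\<in>{i. b i \<inter> K \<in> null_sets lborel}. b i \<inter> K) \<in> null_sets lborel"
      by (rule null_sets_UN') auto
    then show ?thesis by (simp add: Z_def Int_commute)
  qed
  show ?thesis
  proof
    have "open Z" using b by (auto simp: Z_def)
    then show cl: "closed (K - Z)" using K by (simp add: closed_Diff)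
    show "K - Z \<subseteq> K" by auto
    show "K - Z \<noteq> {}"
    proof
      assume "K - Z = {}"
      then have "Z \<inter> K = K" by auto
      with ZK K show False by simp
    qed
    show "\<forall>i. b i \<inter> (K - Z) \<noteq> {} \<longrightarrow> b i \<inter> (K - Z) \<notin> null_sets lborel"
    proof (intro allI impI notI)
      fix i assume i: "b i \<inter> (K - Z) \<noteq> {}"
      assume "b i \<inter> (K - Z) \<in> null_sets lborel"
      \<comment> \<open>Putting back the null part \<open>Z \<inter> K\<close> shows that
        \<open>b i\<close> meets K itself in a null set, so \<open>b i\<close> was removed.\<close>
      then have "b i \<inter> (K - Z) \<union> Z \<inter> K \<in> null_sets lborel" using ZK by blast
      moreover have "b i \<inter> K \<in> sets lborel" using b K by (simp add: borel_closed borel_open sets.Int)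
      moreover have "b i \<inter> K \<subseteq> b i \<inter> (K - Z) \<union> Z \<inter> K" by auto
      ultimately have "b i \<inter> K \<in> null_sets lborel" using null_sets_subset by blast
      then have "b i \<subseteq> Z" by (auto simp: Z_def)
      with i show False by auto
    qed
  qed
qed

text \<open>If every tail union of the G n were dense in K, Baire's theorem would yield a point of K
  in infinitely many G n. So some tail union is not dense, and U is the complement of its
  closure.\<close>

lemma baire_limsup_avoided:
  fixes K :: "real set" and G :: "nat \<Rightarrow> real set"
  assumes K: "closed K" "K \<noteq> {}" and G: "\<And>n. open (G n)"
    and avoid: "\<And>t. t \<in> K \<Longrightarrow> \<not> (\<exists>\<^sub>\<infinity>n. t \<in> G n)"
  obtains m U where "open U" "U \<inter> K \<noteq> {}" "\<And>n. n \<ge> m \<Longrightarrow> U \<inter> K \<inter> G n = {}"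
proof -
  define V where "V m = K \<inter> (\<Union>n\<in>{m..}. G n)" for m :: nat
  have "\<exists>m. \<not> K \<subseteq> closure (V m)"
  proof (rule ccontr)
    assume "\<not> ?thesis"
    then have "openin (top_of_set K) T \<and> K \<subseteq> closure T" if "T \<in> range V" for T
      using that G by (auto simp: V_def intro!: openin_open_Int)
    then have "K \<subseteq> closure (\<Inter>(range V))"
      by (intro Baire K(1)) auto
    with K(2) have "\<Inter>(range V) \<noteq> {}" by auto
    then obtain t where "\<And>m. t \<in> V m" by auto
    then have "t \<in> K" "\<exists>\<^sub>\<infinity>n. t \<in> G n" by (auto simp: V_def INFM_nat_le)
    with avoid show False by blast
  qed
  then obtain m where m: "\<not> K \<subseteq> closure (V m)" by blast
  show ?thesis
  proof
    show "open (- closure (V m))" by auto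
    show "- closure (V m) \<inter> K \<noteq> {}" using m by auto
    fix n assume "n \<ge> m"
    then have "K \<inter> G n \<subseteq> V m" by (auto simp: V_def)
    then show "- closure (V m) \<inter> K \<inter> G n = {}"
      using closure_subset[of "V m"] by auto
  qed
qed

text \<open>Each x in A has a basic portion of \<open>K'\<close> that misses the sets chosen by x
  from some n on. The values missed by one portion form a slalom, and a diagonal union merges the
  countably many portions.\<close>

lemma slalom_if_null_digit_limsups:
  assumes null: "(\<Union>x\<in>A. digit_limsup x) \<in> null_sets lebesgue"
  obtains S where "\<And>n. finite (S n)" "\<And>n. card (S n) \<le> Suc n * (Suc n * 2 ^ Suc n)"
    "\<And>x. x \<in> A \<Longrightarrow> \<forall>\<^sub>F n in sequentially. x n \<in> S n"
proof -
  let ?Z = "\<Union>x\<in>A. digit_limsup x"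
  have Y: "{0..<1} - ?Z \<in> sets lebesgue" using null by auto
  \<comment> \<open>The error 1 is the measure of \<open>{0..<1}\<close>; a null K would make the
    loss at least 1.\<close>
  obtain K where K: "closed K" "K \<subseteq> {0..<1} - ?Z"
    "emeasure lebesgue ({0..<1} - ?Z - K) < ennreal 1"
    using sets_lebesgue_inner_closed[OF Y zero_less_one] by metis
  have Kpos: "K \<notin> null_sets lborel"
  proof
    assume "K \<in> null_sets lborel"
    then have Kn: "?Z \<union> K \<in> null_sets lebesgue"
      using null null_sets.Un null_sets_completionI by blast
    have "emeasure lebesgue {0..<1::real} = emeasure lebesgue ({0..<1} - (?Z \<union> K))"
      by (rule emeasure_Diff_null_set[OF Kn, symmetric]) simp
    also have "{0..<1} - (?Z \<union> K) = {0..<1} - ?Z - K" by auto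
    finally show False using K(3) by simp
  qed
  obtain b :: "nat \<Rightarrow> real set" where b: "\<And>i. open (b i)"
    and base: "\<And>U x. open U \<Longrightarrow> x \<in> U \<Longrightarrow> \<exists>i. x \<in> b i \<and> b i \<subseteq> U"
    using countable_open_base by blast
  obtain K' where K': "closed K'" "K' \<subseteq> K" "K' \<noteq> {}"
    and pos: "\<forall>i. b i \<inter> K' \<noteq> {} \<longrightarrow> b i \<inter> K' \<notin> null_sets lborel"
    by (rule closed_locally_positive_measure_subset[OF K(1) Kpos b])
  define T where "T i n = {k. b i \<inter> K' \<inter> digit_zero (2 ^ Suc n) k = {}}" for i n
  define small where "small i n \<longleftrightarrow> finite (T i n) \<and> card (T i n) \<le> Suc n * 2 ^ Suc n" for i n
  \<comment> \<open>Position n uses only the first n + 1 portions, and only those already within the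
    bound. Each nonempty portion takes part from some n on.\<close>
  define S where "S n = (\<Union>i\<in>{i. i \<le> n \<and> small i n}. T i n)" for n
  have ev_small: "\<forall>\<^sub>F n in sequentially. small i n" if ne: "b i \<inter> K' \<noteq> {}" for i
  proof -
    define \<delta> where "\<delta> = measure lborel (b i \<inter> K')"
    have sub: "b i \<inter> K' \<subseteq> {0..<1}" using K' K by auto
    have meas: "b i \<inter> K' \<in> fmeasurable lborel"
      by (rule fmeasurableI2[of "{0..1}"])
         (use sub b K' in \<open>auto intro: fmeasurable_compact simp: borel_closed borel_open sets.Int\<close>)
    have "\<delta> > 0"
      using pos ne meas unfolding \<delta>_def
      by (metis fmeasurableD fmeasurableD2 null_setsI measure_eq_0_null_sets emeasure_eq_measure2
          ennreal_0 zero_less_measure_iff infinity_ennreal_def)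
    then obtain N where N: "1 < real N * \<delta>" using reals_Archimedean3 by blast
    have "small i n" if n: "n \<ge> N" for n
    proof -
      \<comment> \<open>Finiteness of \<open>T i n\<close> is not known yet, so the estimate is made
        for its finite subsets.\<close>
      have "card H \<le> Suc n * 2 ^ Suc n" if H: "H \<subseteq> T i n" "finite H" for H
      proof -
        have "b i \<inter> K' \<subseteq> digits_avoid (2 ^ Suc n) H \<inter> {0..<1}"
          using H sub by (auto simp: T_def digits_avoid_def)
        from card_le_if_avoids_digits[OF _ H(2) this \<open>\<delta> > 0\<close>]
        have *: "real (card H) * \<delta> \<le> 2 ^ Suc n" by (simp add: \<delta>_def)
        have "real (card H) * 1 \<le> real (card H) * (real (Suc n) * \<delta>)"
        proof (rule mult_left_mono)
          have "real N * \<delta> \<le> real (Suc n) * \<delta>" using n \<open>\<delta> > 0\<close> by simp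
          with N show "1 \<le> real (Suc n) * \<delta>" by linarith
        qed simp
        also have "\<dots> = real (Suc n) * (real (card H) * \<delta>)" by simp
        also have "\<dots> \<le> real (Suc n) * 2 ^ Suc n" using * by (intro mult_left_mono) auto
        finally have "real (card H) \<le> real (Suc n * 2 ^ Suc n)" by (simp add: algebra_simps)
        then show ?thesis by (simp only: of_nat_le_iff)
      qed
      then show ?thesis
        unfolding small_def by (rule finite_if_finite_subsets_card_bdd)
    qed
    then show ?thesis unfolding eventually_sequentially by blast
  qed
  show ?thesis
  proof
    show "finite (S n)" for n by (auto simp: S_def small_def)
    show "card (S n) \<le> Suc n * (Suc n * 2 ^ Suc n)" for n
    proof -
      let ?I = "{i. i \<le> n \<and> small i n}"
      have "card (S n) \<le> (\<Sum>i\<in>?I. card (T i n))"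
        unfolding S_def by (rule card_UN_le) simp
      also have "\<dots> \<le> card ?I * (Suc n * 2 ^ Suc n)"
        using sum_bounded_above[of ?I "\<lambda>i. card (T i n)" "Suc n * 2 ^ Suc n"] by (simp add: small_def)
      also have "card ?I \<le> card {..n}" by (intro card_mono) auto
      then have "card ?I * (Suc n * 2 ^ Suc n) \<le> Suc n * (Suc n * 2 ^ Suc n)"
        by (intro mult_le_mono1) simp
      finally show ?thesis .
    qed
    fix x assume x: "x \<in> A"
    have avoid: "\<not> (\<exists>\<^sub>\<infinity>n. t \<in> digit_zero (2 ^ Suc n) (x n))" if t: "t \<in> K'" for t
    proof -
      have "t \<in> {0..<1}" "t \<notin> digit_limsup x" using t x K'(2) K(2) by auto
      then show ?thesis unfolding digit_limsup_def by blast
    qed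
    obtain m U where U: "open U" "U \<inter> K' \<noteq> {}"
      "\<And>n. n \<ge> m \<Longrightarrow> U \<inter> K' \<inter> digit_zero (2 ^ Suc n) (x n) = {}"
      by (rule baire_limsup_avoided[OF K'(1,3) open_digit_zero avoid]) (assumption, rule that)
    then obtain i where i: "b i \<inter> K' \<noteq> {}" "b i \<subseteq> U" using base by blast
    show "\<forall>\<^sub>F n in sequentially. x n \<in> S n"
      using ev_small[OF i(1)] eventually_ge_at_top[of m] eventually_ge_at_top[of i]
    proof eventually_elim
      case (elim n)
      with U(3)[of n] i(2) have "x n \<in> T i n" by (auto simp: T_def)
      with elim show ?case by (auto simp: S_def)
    qed
  qed
qed

section \<open>Slaloms of slow width\<close>

definition block_code :: "(nat \<Rightarrow> nat) \<Rightarrow> (nat \<Rightarrow> nat) \<Rightarrow> nat \<Rightarrow> nat" where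
  "block_code h x j = to_nat (map x [0..<h (Suc j)])"

lemma block_code_decode:
  "k < h (Suc j) \<Longrightarrow> (from_nat (block_code h x j) :: nat list) ! k = x k"
  by (simp add: block_code_def)

text \<open>A code at position \<open>j\<close> predicts all values below \<open>h (Suc j)\<close>. Reading \<open>x k\<close> off the first
  such \<open>j\<close> leaves at most \<open>h j \<le> k\<close> candidates.\<close>

lemma slow_slalom_if_block_codes_localized:
  fixes h :: "nat \<Rightarrow> nat"
  assumes h: "strict_mono h"
    and S: "\<And>j. finite (S j)" "\<And>j. card (S j) \<le> h j"
    and loc: "\<And>x. x \<in> A \<Longrightarrow> \<forall>\<^sub>F j in sequentially. block_code h x j \<in> S j"
  obtains R where "\<And>k. finite (R k)" "\<And>k. card (R k) = Suc k"
    "\<And>x. x \<in> A \<Longrightarrow> \<forall>\<^sub>F k in sequentially. x k \<in> R k"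
proof -
  define J where "J k = (LEAST j. k < h (Suc j))" for k
  have J: "k < h (Suc (J k))" for k
    unfolding J_def
  proof (rule LeastI)
    show "k < h (Suc k)" using strict_mono_imp_increasing[OF h, of "Suc k"] by simp
  qed
  have J_min: "h j \<le> k" if "j \<le> J k" "j > 0" for j k
  proof -
    have "j - 1 < (LEAST j. k < h (Suc j))" using that by (simp add: J_def)
    then have "\<not> k < h (Suc (j - 1))" by (rule not_less_Least)
    with that show ?thesis by simp
  qed
  have J_large: "m < J k" if "h (Suc m) \<le> k" for m k
  proof (rule ccontr)
    assume "\<not> m < J k"
    then have "h (Suc (J k)) \<le> h (Suc m)"
      using strict_mono_mono[OF h] by (simp add: monoD)
    with J[of k] that show False by simp
  qed
  \<comment> \<open>Below \<open>h 1\<close> the first block is read, whose width \<open>h 0\<close>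
    need not be at most k; these finitely many k are discarded.\<close>
  define Q where "Q k = (if h 1 \<le> k then (\<lambda>c. (from_nat c :: nat list) ! k) ` S (J k) else {})" for k
  \<comment> \<open>Padding with numbers up to k gives exactly the k + 1 elements that a move of
    Player I must have.\<close>
  have "\<exists>R. Q k \<subseteq> R \<and> R \<subseteq> Q k \<union> {..k} \<and> card R = Suc k" for k
  proof (rule exists_subset_between)
    have fin: "finite (Q k)" by (simp add: Q_def S)
    show "card (Q k) \<le> Suc k"
    proof (cases "h 1 \<le> k")
      case True
      have "card (Q k) \<le> card (S (J k))" using True by (simp add: Q_def card_image_le S)
      also have "\<dots> \<le> h (J k)" by (rule S)
      also have "\<dots> \<le> k" using J_min[of "J k" k] J_large[of 0 k] True by simp
      finally show ?thesis by simp
    qed (simp add: Q_def)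
    show "finite (Q k \<union> {..k})" using fin by simp
    then have "card {..k} \<le> card (Q k \<union> {..k})" by (intro card_mono) auto
    then show "Suc k \<le> card (Q k \<union> {..k})" by simp
  qed auto
  then obtain R where R: "\<And>k. Q k \<subseteq> R k" "\<And>k. card (R k) = Suc k"
    by metis
  show ?thesis
  proof
    show "finite (R k)" for k using R(2)[of k] card.infinite by fastforce
    show "card (R k) = Suc k" for k by (rule R)
    fix x assume "x \<in> A"
    then obtain m where m: "\<And>j. j \<ge> m \<Longrightarrow> block_code h x j \<in> S j"
      using loc unfolding eventually_sequentially by blast
    show "\<forall>\<^sub>F k in sequentially. x k \<in> R k"
      using eventually_ge_at_top[of "h (Suc m)"] eventually_ge_at_top[of "h 1"]
    proof eventually_elim
      case (elim k)
      with m[of "J k"] J_large[of m k] have "block_code h x (J k) \<in> S (J k)" by simp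
      then have "x k \<in> Q k"
        using elim block_code_decode[of k h "J k" x, OF J] unfolding Q_def by (metis imageI)
      then show ?case using R(1) by blast
    qed
  qed
qed

text \<open>Player I looks only at the round number. A win of Player II would need an x that leaves
  the slalom infinitely often.\<close>

lemma I_winning_strategy_if_localized:
  assumes R: "\<And>k. finite (R k)" "\<And>k. card (R k) = Suc k"
    and loc: "\<And>x. x \<in> \<A> \<Longrightarrow> \<forall>\<^sub>F k in sequentially. x k \<in> R k"
  shows "I_winning_strategy \<A> (\<lambda>s. R (length s))"
proof -
  have "\<not> II_wins \<A> (playI (\<lambda>s. R (length s)) i) i" for i
  proof
    assume "II_wins \<A> (playI (\<lambda>s. R (length s)) i) i"
    then obtain x where x: "x \<in> \<A>" "infinite {k. x k \<notin> R k}"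
      by (auto simp: II_wins_def playI_def)
    with loc[OF x(1)] show False
      by (simp add: eventually_cofinite[symmetric] cofinite_eq_sequentially[symmetric])
  qed
  then show ?thesis
    by (simp add: I_winning_strategy_def strategyI_def R)
qed

text \<open>Were the union of the null sets assigned to the block codes null, a single slalom would
  localize all of \<open>\<A>\<close> and Player I would win.\<close>

lemma addN_family_if_game_family:
  assumes "game_family \<A>"
  obtains F where "addN_family F" "|F| \<le>o |\<A>|"
proof -
  \<comment> \<open>Exactly the slalom width obtained from a null union, so that block codes absorb
    it.\<close>
  define h :: "nat \<Rightarrow> nat" where "h n = Suc n * (Suc n * 2 ^ Suc n)" for n
  have h: "strict_mono h"
    unfolding h_def strict_mono_Suc_iff by (intro allI mult_strict_mono) auto
  let ?F = "(\<lambda>x. digit_limsup (block_code h x)) ` \<A>"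
  have "\<Union>?F \<notin> null_sets lebesgue"
  proof
    assume "\<Union>?F \<in> null_sets lebesgue"
    then have "(\<Union>x\<in>block_code h ` \<A>. digit_limsup x) \<in> null_sets lebesgue" by (simp add: image_image)
    then obtain S where S: "\<And>n. finite (S n)" "\<And>n. card (S n) \<le> h n"
      and "\<And>x. x \<in> block_code h ` \<A> \<Longrightarrow> \<forall>\<^sub>F n in sequentially. x n \<in> S n"
      unfolding h_def by (rule slalom_if_null_digit_limsups) blast
    then have "\<And>x. x \<in> \<A> \<Longrightarrow> \<forall>\<^sub>F n in sequentially. block_code h x n \<in> S n" by blast
    from slow_slalom_if_block_codes_localized[OF h S this] obtain R
      where "\<And>k. finite (R k)" "\<And>k. card (R k) = Suc k"
        "\<And>x. x \<in> \<A> \<Longrightarrow> \<forall>\<^sub>F k in sequentially. x k \<in> R k" by blast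
    then have "I_winning_strategy \<A> (\<lambda>s. R (length s))" by (rule I_winning_strategy_if_localized)
    with assms show False by (auto simp: game_family_def)
  qed
  then have "addN_family ?F"
    using null_digit_limsup by (auto simp: addN_family_def)
  then show ?thesis using card_of_image that by blast
qed

section \<open>From slaloms to null sets\<close>

text \<open>Finite unions \<open>E r\<close> of basic sets increase to U. Differences of successive
  terms of a fast subsequence cover U, and each lies in a remainder whose measure meets the
  prescribed tolerance.\<close>

lemma open_cover_codes:
  fixes b :: "nat \<Rightarrow> real set" and \<epsilon> :: "nat \<Rightarrow> real"
  assumes b: "\<And>i. open (b i)" and base: "\<And>U x. open U \<Longrightarrow> x \<in> U \<Longrightarrow> \<exists>i. x \<in> b i \<and> b i \<subseteq> U"
    and \<epsilon>: "\<And>i. \<epsilon> i > 0" and U: "open U" "emeasure lborel U \<le> ennreal (\<epsilon> 0)"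
  obtains I J :: "nat \<Rightarrow> nat list"
  where "\<And>i. emeasure lborel ((\<Union>l\<in>set (I i). b l) - (\<Union>l\<in>set (J i). b l)) \<le> ennreal (\<epsilon> i)"
    "U \<subseteq> (\<Union>i. (\<Union>l\<in>set (I i). b l) - (\<Union>l\<in>set (J i). b l))"
proof -
  define L where "L r = filter (\<lambda>l. b l \<subseteq> U) [0..<r]" for r
  define E where "E r = (\<Union>l\<in>set (L r). b l)" for r
  have E_sub: "E r \<subseteq> U" for r by (auto simp: E_def L_def)
  have E_open: "open (E r)" for r unfolding E_def using b by (intro open_UN) auto
  have E_mono: "E r \<subseteq> E s" if "r \<le> s" for r s
    using that by (force simp: E_def L_def)
  have E_cover: "\<exists>r. t \<in> E r" if t: "t \<in> U" for t
  proof -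
    obtain l where "t \<in> b l" "b l \<subseteq> U" using base[OF U(1) t] by blast
    then have "t \<in> E (Suc l)" by (auto simp: E_def L_def)
    then show ?thesis ..
  qed
  have fin: "emeasure lborel (U - E r) \<noteq> \<infinity>" for r
  proof -
    have "emeasure lborel (U - E r) \<le> emeasure lborel U" using U by (intro emeasure_mono) auto
    with U show ?thesis by (metis ennreal_less_top infinity_ennreal_def leD order.trans)
  qed
  have "(\<lambda>r. emeasure lborel (U - E r)) \<longlonglongrightarrow> emeasure lborel (\<Inter>r. U - E r)"
    using U E_open E_mono fin by (intro Lim_emeasure_decseq) (auto simp: decseq_def)
  moreover have "(\<Inter>r. U - E r) = {}" using E_cover by blast
  ultimately have lim: "(\<lambda>r. emeasure lborel (U - E r)) \<longlonglongrightarrow> 0"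
    by (simp only: emeasure_empty)
  have "\<exists>r\<ge>i. emeasure lborel (U - E r) < ennreal (\<epsilon> i)" for i
  proof -
    have "\<forall>\<^sub>F r in sequentially. emeasure lborel (U - E r) < ennreal (\<epsilon> i)"
      using order_tendstoD(2)[OF lim] \<epsilon> by simp
    from eventually_conj[OF this eventually_ge_at_top[of i]] show ?thesis
      by (auto dest: eventually_happens)
  qed
  then obtain \<rho> where \<rho>: "\<And>i. \<rho> i \<ge> i" "\<And>i. emeasure lborel (U - E (\<rho> i)) < ennreal (\<epsilon> i)"
    by metis
  \<comment> \<open>Starting from the empty union makes the first remainder U itself, which the
    hypothesis on \<open>\<epsilon> 0\<close> controls.\<close>
  define N where "N i = (if i = 0 then 0 else \<rho> i)" for i
  have N0: "E (N 0) = {}" by (simp add: N_def E_def L_def)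
  have N: "N i \<ge> i" for i using \<rho>(1) by (simp add: N_def)
  have small: "emeasure lborel (U - E (N i)) \<le> ennreal (\<epsilon> i)" for i
    using \<rho>(2)[of i] U(2) N0 by (cases "i = 0") (auto simp: N_def)
  show ?thesis
  proof
    fix i
    have "emeasure lborel (E (N (Suc i)) - E (N i)) \<le> emeasure lborel (U - E (N i))"
      using U E_open E_sub by (intro emeasure_mono) auto
    also note small
    finally show "emeasure lborel ((\<Union>l\<in>set (L (N (Suc i))). b l) - (\<Union>l\<in>set (L (N i)). b l)) \<le> ennreal (\<epsilon> i)"
      unfolding E_def .
  next
    show "U \<subseteq> (\<Union>i. (\<Union>l\<in>set (L (N (Suc i))). b l) - (\<Union>l\<in>set (L (N i)). b l))"
    proof
      fix t assume "t \<in> U"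
      then obtain r where "t \<in> E r" using E_cover by blast
      then have ex: "t \<in> E (N r)" using E_mono[OF N] by blast
      define i where "i = (LEAST i. t \<in> E (N i))"
      have "t \<in> E (N i)" unfolding i_def using ex by (rule LeastI)
      then obtain i' where i': "i = Suc i'" using N0 by (cases i) auto
      have "t \<notin> E (N i')" using not_less_Least[of i' "\<lambda>i. t \<in> E (N i)"] i' unfolding i_def by simp
      with \<open>t \<in> E (N i)\<close> i' have "t \<in> E (N (Suc i')) - E (N i')" by simp
      then show "t \<in> (\<Union>i. (\<Union>l\<in>set (L (N (Suc i))). b l) - (\<Union>l\<in>set (L (N i)). b l))"
        unfolding E_def by blast
    qed
  qed
qed

text \<open>One D serves all null sets, since pairs of finite lists are coded by numbers. For each m
  the null set is covered by a row of coded pieces; a point lies in a piece of every row, hence in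
  infinitely many.\<close>

lemma null_set_codes:
  obtains D :: "nat \<Rightarrow> real set" where "\<And>c. D c \<in> sets lborel"
    "\<And>X \<epsilon>. X \<in> null_sets lebesgue \<Longrightarrow> (\<And>k::nat. \<epsilon> k > (0::real)) \<Longrightarrow>
      \<exists>f. (\<forall>k. emeasure lborel (D (f k)) \<le> ennreal (\<epsilon> k)) \<and> (\<forall>t\<in>X. \<exists>\<^sub>\<infinity>k. t \<in> D (f k))"
proof -
  obtain b :: "nat \<Rightarrow> real set" where b: "\<And>i. open (b i)"
    and base: "\<And>U x. open U \<Longrightarrow> x \<in> U \<Longrightarrow> \<exists>i. x \<in> b i \<and> b i \<subseteq> U"
    using countable_open_base by blast
  define D where "D c = (case from_nat c of (I :: nat list, J :: nat list) \<Rightarrow>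
    (\<Union>l\<in>set I. b l) - (\<Union>l\<in>set J. b l))" for c
  have D_to_nat: "D (to_nat (I, J)) = (\<Union>l\<in>set I. b l) - (\<Union>l\<in>set J. b l)" for I J
    by (simp add: D_def)
  show ?thesis
  proof
    show "D c \<in> sets lborel" for c
      using b by (auto simp: D_def borel_open open_UN split: prod.split intro!: sets.Diff)
    fix X :: "real set" and \<epsilon> :: "nat \<Rightarrow> real"
    assume X: "X \<in> null_sets lebesgue" and \<epsilon>: "\<And>k. \<epsilon> k > 0"
    \<comment> \<open>Row m uses the tolerances at the positions \<open>prod_encode (m, i)\<close>,
      where its pieces will be placed.\<close>
    have "\<exists>f. (\<forall>i. emeasure lborel (D (f i)) \<le> ennreal (\<epsilon> (prod_encode (m, i)))) \<and> X \<subseteq> (\<Union>i. D (f i))" for m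
    proof -
      obtain U where U: "open U" "X \<subseteq> U" "U - X \<in> lmeasurable"
        "emeasure lebesgue (U - X) < ennreal (\<epsilon> (prod_encode (m, 0)))"
        using sets_lebesgue_outer_open[of X "\<epsilon> (prod_encode (m, 0))"] X \<epsilon> by blast
      have "emeasure lebesgue U = emeasure lebesgue (U - X)"
        by (rule emeasure_Diff_null_set[OF X, symmetric]) (use U in auto)
      with U have "emeasure lborel U \<le> ennreal (\<epsilon> (prod_encode (m, 0)))"
        by (simp add: borel_open)
      from open_cover_codes[OF b base, of "\<lambda>i. \<epsilon> (prod_encode (m, i))" U, OF _ _ \<epsilon> U(1) this]
      obtain I J :: "nat \<Rightarrow> nat list" where
        IJ: "\<And>i. emeasure lborel (D (to_nat (I i, J i))) \<le> ennreal (\<epsilon> (prod_encode (m, i)))"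
          "U \<subseteq> (\<Union>i. D (to_nat (I i, J i)))"
        unfolding D_to_nat by blast
      show ?thesis
        by (rule exI[of _ "\<lambda>i. to_nat (I i, J i)"]) (use IJ U(2) in blast)
    qed
    then obtain f where f: "\<And>m i. emeasure lborel (D (f m i)) \<le> ennreal (\<epsilon> (prod_encode (m, i)))"
      "\<And>m. X \<subseteq> (\<Union>i. D (f m i))" by metis
    define g where "g k = (case prod_decode k of (m, i) \<Rightarrow> f m i)" for k
    have g: "g (prod_encode (m, i)) = f m i" for m i by (simp add: g_def)
    show "\<exists>f. (\<forall>k. emeasure lborel (D (f k)) \<le> ennreal (\<epsilon> k)) \<and> (\<forall>t\<in>X. \<exists>\<^sub>\<infinity>k. t \<in> D (f k))"
    proof (intro exI conjI allI ballI)
      show "emeasure lborel (D (g k)) \<le> ennreal (\<epsilon> k)" for k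
        using f(1)[of "fst (prod_decode k)" "snd (prod_decode k)"]
        by (simp add: g_def case_prod_beta)
      fix t assume "t \<in> X"
      show "\<exists>\<^sub>\<infinity>k. t \<in> D (g k)"
        unfolding INFM_nat_le
      proof
        fix m
        obtain i where "t \<in> D (f m i)" using f(2) \<open>t \<in> X\<close> by blast
        then have "t \<in> D (g (prod_encode (m, i)))" by (simp add: g)
        \<comment> \<open>The position of a piece of row m is at least m.\<close>
        then show "\<exists>k\<ge>m. t \<in> D (g k)" using le_prod_encode_1 by blast
      qed
    qed
  qed
qed

text \<open>The play against \<open>\<sigma>\<close> in which Player II answers truthfully according to \<open>x\<close>.\<close>

fun honest_history :: "(bool list \<Rightarrow> nat set) \<Rightarrow> (nat \<Rightarrow> nat) \<Rightarrow> nat \<Rightarrow> bool list" where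
  "honest_history \<sigma> x 0 = []"
| "honest_history \<sigma> x (Suc k) = honest_history \<sigma> x k @ [x k \<notin> \<sigma> (honest_history \<sigma> x k)]"

text \<open>Indexed by finite lists, so there are only countably many. The empty value before the
  end of s is harmless, as only almost all k count.\<close>

definition slalom_after :: "(bool list \<Rightarrow> nat set) \<Rightarrow> bool list \<Rightarrow> nat \<Rightarrow> nat set" where
  "slalom_after \<sigma> s k = (if k < length s then {} else \<sigma> (s @ replicate (k - length s) False))"

text \<open>Player II wins with \<open>x\<close> unless the honest answers are eventually constantly 0, and then
  Player I's moves depend only on the finite history before that.\<close>

lemma I_winning_localizes:
  assumes win: "I_winning_strategy \<A> \<sigma>" and x: "x \<in> \<A>"
  obtains s where "\<forall>\<^sub>F k in sequentially. x k \<in> slalom_after \<sigma> s k"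
proof -
  let ?h = "honest_history \<sigma> x"
  define i where "i k \<longleftrightarrow> x k \<notin> \<sigma> (?h k)" for k
  have hist: "map i [0..<k] = ?h k" for k
    by (induction k) (simp_all add: i_def)
  have "\<not> II_wins \<A> (playI \<sigma> i) i" using win by (simp add: I_winning_strategy_def)
  \<comment> \<open>Under honest answers x itself witnesses the second winning condition, so the
    first one must fail.\<close>
  then have "finite {k. i k}"
    using x by (auto simp: II_wins_def playI_def hist i_def)
  then obtain K where K: "\<And>k. i k \<Longrightarrow> k < K"
    by (auto simp: finite_nat_iff_bounded)
  have len: "length (?h k) = k" for k by (induction k) auto
  have h: "?h k = ?h K @ replicate (k - K) False" if "k \<ge> K" for k
    using that
  proof (induction k rule: dec_induct)
    case (step k)
    then have "\<not> i k" using K by fastforce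
    with step show ?case by (simp add: i_def Suc_diff_le replicate_append_same)
  qed simp
  have "x k \<in> slalom_after \<sigma> (?h K) k" if "k \<ge> K" for k
  proof -
    have "\<not> i k" using K that by fastforce
    with h[OF that] that show ?thesis by (simp add: slalom_after_def len i_def)
  qed
  then show ?thesis using that unfolding eventually_sequentially by blast
qed

lemma slalom_after_finite_card:
  assumes "strategyI \<sigma>"
  shows "finite (slalom_after \<sigma> s k)" "card (slalom_after \<sigma> s k) \<le> Suc k"
  using assms by (auto simp: strategyI_def slalom_after_def)

text \<open>At most k + 1 sets of measure at most 4^-k contribute at k, in total at most 2^-k, so
  Borel-Cantelli applies. The filter drops codes of sets that are too large.\<close>

lemma null_slalom_limsup:
  fixes D :: "nat \<Rightarrow> real set"
  assumes D: "\<And>c. D c \<in> sets lborel" and S: "\<And>k. finite (S k)" "\<And>k. card (S k) \<le> Suc k"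
  shows "{t. \<exists>\<^sub>\<infinity>k. t \<in> (\<Union>c\<in>{c \<in> S k. emeasure lborel (D c) \<le> ennreal ((1 / 4) ^ k)}. D c)}
    \<in> null_sets lborel"
proof (rule null_limsup)
  let ?S = "\<lambda>k. {c \<in> S k. emeasure lborel (D c) \<le> ennreal ((1 / 4) ^ k)}"
  show "(\<Union>c\<in>?S k. D c) \<in> sets lborel" for k using D S by auto
  have le: "emeasure lborel (\<Union>c\<in>?S k. D c) \<le> ennreal (real (Suc k) * (1 / 4) ^ k)" for k
  proof -
    have "emeasure lborel (\<Union>c\<in>?S k. D c) \<le> (\<Sum>c\<in>?S k. emeasure lborel (D c))"
      using D S by (intro emeasure_subadditive_finite) auto
    also have "\<dots> \<le> (\<Sum>c\<in>?S k. ennreal ((1 / 4) ^ k))" by (intro sum_mono) auto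
    also have "\<dots> = ennreal (real (card (?S k)) * (1 / 4) ^ k)"
      by (simp add: ennreal_of_nat_eq_real_of_nat ennreal_mult)
    also have "\<dots> \<le> ennreal (real (Suc k) * (1 / 4) ^ k)"
    proof (intro ennreal_leI mult_right_mono)
      have "card (?S k) \<le> card (S k)" using S by (intro card_mono) auto
      with S(2)[of k] show "real (card (?S k)) \<le> real (Suc k)" by linarith
    qed simp
    finally show ?thesis .
  qed
  then show "emeasure lborel (\<Union>c\<in>?S k. D c) \<noteq> \<infinity>" for k
    by (metis ennreal_less_top infinity_ennreal_def leD)
  have "summable (\<lambda>k. (1 / 2 :: real) ^ k)" by (simp add: summable_geometric)
  then show "summable (\<lambda>k. measure lborel (\<Union>c\<in>?S k. D c))"
  proof (rule summable_comparison_test'[where N = 0])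
    fix k
    have "real (Suc k) \<le> 2 ^ k" using less_exp[of k]
      by (metis Suc_leI numeral_power_eq_of_nat_cancel_iff of_nat_le_iff of_nat_numeral of_nat_power)
    then have "real (Suc k) * (1 / 4) ^ k \<le> 2 ^ k * (1 / 4) ^ k" by (intro mult_right_mono) auto
    also have "\<dots> = (1 / 2 :: real) ^ k" by (simp add: power_mult_distrib[symmetric])
    finally have "real (Suc k) * (1 / 4) ^ k \<le> (1 / 2 :: real) ^ k" .
    moreover have "measure lborel (\<Union>c\<in>?S k. D c) \<le> real (Suc k) * (1 / 4) ^ k"
      using le[of k] unfolding measure_def by (intro enn2real_leI) auto
    ultimately show "norm (measure lborel (\<Union>c\<in>?S k. D c)) \<le> (1 / 2) ^ k" by simp
  qed
qed

text \<open>Every null set in F is replaced by a code function. A winning strategy against these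
  functions would localize them by countably many slaloms, whose null sets would cover
  \<open>\<Union>F\<close>.\<close>

lemma game_family_if_addN_family:
  assumes F: "addN_family F"
  obtains \<A> where "game_family \<A>" "|\<A>| \<le>o |F|"
proof -
  obtain D :: "nat \<Rightarrow> real set" where D: "\<And>c. D c \<in> sets lborel"
    and codes: "\<And>X \<epsilon>. X \<in> null_sets lebesgue \<Longrightarrow> (\<And>k::nat. \<epsilon> k > (0::real)) \<Longrightarrow>
      \<exists>f. (\<forall>k. emeasure lborel (D (f k)) \<le> ennreal (\<epsilon> k)) \<and> (\<forall>t\<in>X. \<exists>\<^sub>\<infinity>k. t \<in> D (f k))"
    using null_set_codes by blast
  have "\<exists>f. (\<forall>k. emeasure lborel (D (f k)) \<le> ennreal ((1 / 4) ^ k)) \<and> (\<forall>t\<in>X. \<exists>\<^sub>\<infinity>k. t \<in> D (f k))"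
    if "X \<in> F" for X
    using codes[of X "\<lambda>k. (1 / 4) ^ k"] F that by (auto simp: addN_family_def)
  then obtain f where f: "\<And>X k. X \<in> F \<Longrightarrow> emeasure lborel (D (f X k)) \<le> ennreal ((1 / 4) ^ k)"
    "\<And>X t. X \<in> F \<Longrightarrow> t \<in> X \<Longrightarrow> \<exists>\<^sub>\<infinity>k. t \<in> D (f X k)"
    by metis
  have "game_family (f ` F)"
    unfolding game_family_def
  proof
    assume "\<exists>\<sigma>. I_winning_strategy (f ` F) \<sigma>"
    then obtain \<sigma> where win: "I_winning_strategy (f ` F) \<sigma>" ..
    then have strat: "strategyI \<sigma>" by (simp add: I_winning_strategy_def)
    define N where "N s = {t. \<exists>\<^sub>\<infinity>k. t \<in> (\<Union>c\<in>{c \<in> slalom_after \<sigma> s k.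
      emeasure lborel (D c) \<le> ennreal ((1 / 4) ^ k)}. D c)}" for s
    have "N s \<in> null_sets lborel" for s
      unfolding N_def by (intro null_slalom_limsup D slalom_after_finite_card strat)
    then have "(\<Union>s. N s) \<in> null_sets lborel" by (rule null_sets_UN)
    moreover have "\<Union>F \<subseteq> (\<Union>s. N s)"
    proof
      fix t assume "t \<in> \<Union>F"
      then obtain X where X: "X \<in> F" "t \<in> X" by blast
      obtain s where s: "\<forall>\<^sub>F k in sequentially. f X k \<in> slalom_after \<sigma> s k"
        using I_winning_localizes[OF win] X(1) by blast
      have "\<exists>\<^sub>\<infinity>k. f X k \<in> slalom_after \<sigma> s k \<and> t \<in> D (f X k)"
        using INFM_conjI[OF f(2)[OF X]] s
        by (smt (verit, best) INFM_mono cofinite_eq_sequentially)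
      then have "t \<in> N s"
        unfolding N_def mem_Collect_eq by (rule INFM_mono) (use f(1)[OF X(1)] in blast)
      then show "t \<in> (\<Union>s. N s)" by blast
    qed
    \<comment> \<open>Completeness of Lebesgue measure handles \<open>\<Union>F\<close>, which is
      not known to be measurable.\<close>
    ultimately have "\<Union>F \<in> null_sets lebesgue"
      using null_sets_completion_subset null_sets_completionI by blast
    with F show False by (simp add: addN_family_def)
  qed
  then show ?thesis using card_of_image that by blast
qed

section \<open>Comparison of the least cardinalities\<close>

lemma ex_card_of_minimal:
  assumes "P (A :: 'a set)"
  obtains B where "P B" "\<And>C. P C \<Longrightarrow> |B| \<le>o |C|"
proof -
  have "\<exists>r \<in> card_of ` Collect P. \<forall>r' \<in> card_of ` Collect P. r \<le>o r'"
    by (rule exists_minim_Card_order) (use assms in \<open>auto simp: card_of_Card_order\<close>)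
  then show ?thesis using that by blast
qed

theorem mainTheorem9:
  shows "\<exists>F \<A>. addN_min F \<and> game_min \<A> \<and> (card_of F, card_of \<A>) \<in> ordIso"
proof -
  \<comment> \<open>The singletons cover the real line, so some family exists and a least
    cardinality is attained.\<close>
  have "addN_family (range (\<lambda>t. {t}))"
    by (auto simp: addN_family_def null_sets_def)
  then obtain F where F: "addN_family F" "\<And>F'. addN_family F' \<Longrightarrow> |F| \<le>o |F'|"
    by (rule ex_card_of_minimal) blast
  obtain \<A> where \<A>: "game_family \<A>" "|\<A>| \<le>o |F|"
    using game_family_if_addN_family[OF F(1)] by blast
  \<comment> \<open>Every game family is at least as large as F, hence as \<open>\<A>\<close>; this
    gives both the minimality of \<open>\<A>\<close> and the missing inequality.\<close>
  have le: "|F| \<le>o |\<A>'|" if "game_family \<A>'" for \<A>'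
    using addN_family_if_game_family[OF that] F(2) ordLeq_transitive by blast
  have "game_min \<A>"
    using \<A> le ordLeq_transitive by (auto simp: game_min_def)
  moreover have "addN_min F" using F by (simp add: addN_min_def)
  moreover have "|F| =o |\<A>|" using le[OF \<A>(1)] \<A>(2) by (simp add: ordIso_iff_ordLeq)
  ultimately show ?thesis by blast
qed

end
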